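(* Let $M$ be a lattice path matroid without loops or coloops that is not (isomorphic to) a direct sum of trivial snakes. Then \[ T(M;2,0)\cdot T(M;0,2)\geq \frac{4}{3}\cdot T(M;1,1)^2 . \]
   Context: For a matroid $M$ on ground set $E$ with rank function $r$, the Tutte polynomial is $T(M;x,y)=\sum_{A\subseteq E}(x-1)^{r(E)-r(A)}(y-1)^{|A|-r(A)}$. Lattice path matroids: a lattice path is a sequence of unit steps $N=(0,1)$ and $E=(1,0)$ starting at the origin. A lattice path with $m+r$ steps ending at $(m,r)$ is encoded by the set $\{s_1<\dots<s_r\}\subseteq\{1,\dots,m+r\}$ of positions of its North steps. Given two such paths $P=\{s_1<\dots<s_r\}$ and $Q=\{t_1<\dots<t_r\}$ ending at $(m,r)$ with $P$ never going above $Q$ (equivalently $t_i\le s_i$ for all $i$), the lattice path matroid $M[P,Q]$ is the transversal matroid on $\{1,\dots,m+r\}$ with presentation $(A_1,\dots,A_r)$, $A_i=\{t_i,t_i+1,\dots,s_i\}$; its bases are the sets $\{x_1,\dots,x_r\}$ of $r$ distinct elements with $x_i\in A_i$. Equivalently, an $r$-subset $B$ is a basis iff the lattice path whose North steps are at the positions in $B$ stays in the closed region bounded by $P$ and $Q$ (the diagram of $M[P,Q]$). A lattice path matroid (LPM) is a matroid isomorphic to some $M[P,Q]$. The trivial snake is the LPM $M[P,Q]$ with $P=EN$, $Q=NE$ (diagram a single unit square); it is the matroid on two elements that are parallel, i.e. $U_{1,2}$. *)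

theory Defs
  imports Complex_Main
begin

record 'a indep_system =
  ground :: "'a set"
  indep :: "'a set set"

locale matroid =
  fixes M :: "'a indep_system"
  assumes finite_ground: "finite (ground M)"
    and indep_subset_ground: "X \<in> indep M \<Longrightarrow> X \<subseteq> ground M"
    and indep_empty: "{} \<in> indep M"
    and indep_subset: "X \<in> indep M \<Longrightarrow> Y \<subseteq> X \<Longrightarrow> Y \<in> indep M"
    and indep_augment: "X \<in> indep M \<Longrightarrow> Y \<in> indep M \<Longrightarrow> card X < card Y
                          \<Longrightarrow> \<exists>y\<in>Y - X. insert y X \<in> indep M"

definition rank :: "'a indep_system \<Rightarrow> 'a set \<Rightarrow> nat" where
  "rank M A = Max (card ` {X \<in> indep M. X \<subseteq> A})"

text \<open>For a matroid, rank is monotone and bounded by cardinality, so the natural number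
  subtractions in the exponents are exact. The convention \<open>0 ^ 0 = 1\<close> makes this the value
  of the Tutte polynomial also at \<open>x = 1\<close> or \<open>y = 1\<close>.\<close>

definition tutte :: "'a indep_system \<Rightarrow> real \<Rightarrow> real \<Rightarrow> real" where
  "tutte M x y = (\<Sum>A\<in>Pow (ground M).
     (x - 1) ^ (rank M (ground M) - rank M A) * (y - 1) ^ (card A - rank M A))"

definition basis :: "'a indep_system \<Rightarrow> 'a set \<Rightarrow> bool" where
  "basis M B \<longleftrightarrow> B \<in> indep M \<and> (\<forall>X\<in>indep M. B \<subseteq> X \<longrightarrow> X = B)"

definition is_loop :: "'a indep_system \<Rightarrow> 'a \<Rightarrow> bool" where
  "is_loop M e \<longleftrightarrow> e \<in> ground M \<and> {e} \<notin> indep M"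

definition is_coloop :: "'a indep_system \<Rightarrow> 'a \<Rightarrow> bool" where
  "is_coloop M e \<longleftrightarrow> e \<in> ground M \<and> (\<forall>B. basis M B \<longrightarrow> e \<in> B)"

definition matroid_iso :: "'a indep_system \<Rightarrow> 'b indep_system \<Rightarrow> bool" where
  "matroid_iso M M' \<longleftrightarrow> (\<exists>f. bij_betw f (ground M) (ground M') \<and>
     (\<forall>X. X \<subseteq> ground M \<longrightarrow> (X \<in> indep M \<longleftrightarrow> f ` X \<in> indep M')))"

text \<open>The ground set is the disjoint union of the ground sets of the summands.\<close>

definition direct_sum :: "'i set \<Rightarrow> ('i \<Rightarrow> 'a indep_system) \<Rightarrow> ('i \<times> 'a) indep_system" where
  "direct_sum I M =
     \<lparr>ground = Sigma I (\<lambda>i. ground (M i)),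
      indep = {X. X \<subseteq> Sigma I (\<lambda>i. ground (M i)) \<and> (\<forall>i\<in>I. X `` {i} \<in> indep (M i))}\<rparr>"

text \<open>The independent sets are the partial transversals of the family \<open>(A i)\<close>, \<open>i \<in> I\<close>.\<close>

definition transversal_matroid :: "'a set \<Rightarrow> 'i set \<Rightarrow> ('i \<Rightarrow> 'a set) \<Rightarrow> 'a indep_system" where
  "transversal_matroid S I A =
     \<lparr>ground = S,
      indep = {X. X \<subseteq> S \<and> (\<exists>\<phi>. inj_on \<phi> X \<and> \<phi> ` X \<subseteq> I \<and> (\<forall>x\<in>X. x \<in> A (\<phi> x)))}\<rparr>"

datatype step = North | East

type_synonym path = "step list"

definition path_to :: "nat \<Rightarrow> nat \<Rightarrow> path \<Rightarrow> bool" where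
  "path_to m r P \<longleftrightarrow> count_list P East = m \<and> count_list P North = r"

text \<open>After equally many steps two paths are on a common antidiagonal, where being above
  means having taken more North steps.\<close>

definition never_above :: "path \<Rightarrow> path \<Rightarrow> bool" where
  "never_above P Q \<longleftrightarrow> (\<forall>k. count_list (take k P) North \<le> count_list (take k Q) North)"

text \<open>Steps are numbered from 1, whereas North steps, and with them the sets of the presentation,
  are indexed from 0: \<open>north_pos P i\<close> is the element \<open>s\<^sub>i\<^sub>+\<^sub>1\<close> of
  \<open>north_steps P = {s\<^sub>1 < \<dots> < s\<^sub>r}\<close>.\<close>

definition north_steps :: "path \<Rightarrow> nat set" where
  "north_steps P = {j \<in> {1..length P}. P ! (j - 1) = North}"

definition north_pos :: "path \<Rightarrow> nat \<Rightarrow> nat" where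
  "north_pos P i = sorted_list_of_set (north_steps P) ! i"

definition lpm :: "path \<Rightarrow> path \<Rightarrow> nat indep_system" where
  "lpm P Q = transversal_matroid {1..length P} {..<count_list P North}
     (\<lambda>i. {north_pos Q i..north_pos P i})"

definition lattice_path_matroid :: "'a indep_system \<Rightarrow> bool" where
  "lattice_path_matroid M \<longleftrightarrow> matroid M \<and>
     (\<exists>m r P Q. path_to m r P \<and> path_to m r Q \<and> never_above P Q \<and> matroid_iso M (lpm P Q))"

definition trivial_snake :: "nat indep_system" where
  "trivial_snake = lpm [East, North] [North, East]"

text \<open>The empty direct sum, i.e. the matroid on the empty ground set, is included.\<close>

definition sum_of_trivial_snakes :: "'a indep_system \<Rightarrow> bool" where
  "sum_of_trivial_snakes M \<longleftrightarrow>
     (\<exists>k::nat. matroid_iso M (direct_sum {..<k} (\<lambda>_. trivial_snake)))"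

end

theory Submission
  imports Defs "HOL-Library.Function_Algebras"
begin

text \<open>
  Cutting the diagram at a lattice point \<open>z\<close> gives a smaller lattice path matroid, and deleting
  or contracting its last element shows that the Tutte polynomials of these truncations satisfy
  \<open>T(z) = T(left of z) + T(below z)\<close>, with \<open>T(z) = x T(below z)\<close> after a North step of \<open>Q\<close>
  and \<open>T(z) = y T(left of z)\<close> after an East step of \<open>P\<close>. The inequality, read as a condition on
  the triple of values at \<open>(2,0)\<close>, \<open>(0,2)\<close> and \<open>(1,1)\<close>, is preserved by addition
  (Cauchy-Schwarz) and by multiplication.

  If some antidiagonal of the diagram has at least three points, then the last step from three
  points to two splits the rest of the computation, which is linear, into a sum of two: one
  starting from the upper two of the three points, one from the lower two. Both belong to
  diagrams with one step less. The remaining diagrams are chains of snakes, where the antidiagonals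
  have at most two points \<open>v\<close>, \<open>w\<close>, and there the inequalities
  \<open>2 v(1,1) (v+w)(1,1) \<le> v(2,0) (v+w)(0,2)\<close> and \<open>2 w(1,1) (v+w)(1,1) \<le> (v+w)(2,0) w(0,2)\<close> are
  invariant; every snake of more than one square satisfies the bound with \<open>4/3\<close>.
\<close>

section \<open>The recursion along antidiagonals\<close>

type_synonym plane_fun = "real \<times> real \<Rightarrow> real"

fun adj_sums :: "'b::plus list \<Rightarrow> 'b list" where
  "adj_sums (v # w # V) = (v + w) # adj_sums (w # V)"
| "adj_sums _ = []"

lemma length_adj_sums [simp]: "length (adj_sums V) = length V - 1"
  by (induction V rule: adj_sums.induct) auto

lemma adj_sums_nth: "Suc k < length V \<Longrightarrow> adj_sums V ! k = V ! k + V ! Suc k"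
  by (induction V arbitrary: k rule: adj_sums.induct) (auto simp: nth_Cons split: nat.splits)

lemma adj_sums_butlast: "butlast (adj_sums V) = adj_sums (butlast V)"
proof (induction V rule: adj_sums.induct)
  case (1 v w V)
  then show ?case by (cases V) auto
qed auto

lemma adj_sums_tl: "tl (adj_sums V) = adj_sums (tl V)"
  by (cases V rule: adj_sums.cases) auto

text \<open>Values are listed from the highest point down, so neighbours are
  \<open>f (Suc j)\<close> and \<open>f j\<close>, and a recurrence between antidiagonals becomes
  \<open>adj_sums\<close>.\<close>

lemma adj_sums_rev_upt:
  assumes "l \<le> h" "\<And>j. l \<le> j \<Longrightarrow> j < h \<Longrightarrow> g (Suc j) = f (Suc j) + f j"
  shows "adj_sums (map f (rev [l..<Suc h])) = map g (rev [Suc l..<Suc h])"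
  using assms
proof (induction h rule: dec_induct)
  case base
  then show ?case by simp
next
  case (step h)
  then show ?case by simp
qed

text \<open>\<open>reach n b V\<close>: the list \<open>V\<close> holds, from top to bottom, the values at the points of the
  \<open>n\<close>-th antidiagonal of a diagram in which \<open>P\<close> and \<open>Q\<close> have no step in common. The flag \<open>b\<close> says
  that the diagram is not a chain of unit squares. The four rules are the four combinations of
  the next steps of \<open>Q\<close> and \<open>P\<close>; \<open>fst\<close> and \<open>snd\<close> are the coordinate functions \<open>x\<close> and \<open>y\<close>.\<close>

inductive reach :: "nat \<Rightarrow> bool \<Rightarrow> plane_fun list \<Rightarrow> bool" where
  init: "reach 0 False [1]"
| widen: "reach n b V \<Longrightarrow>
    reach (Suc n) (b \<or> 1 < length V) (fst * hd V # adj_sums V @ [snd * last V])"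
| up: "reach n b V \<Longrightarrow> 2 \<le> length V \<Longrightarrow> reach (Suc n) True (fst * hd V # adj_sums V)"
| right: "reach n b V \<Longrightarrow> 2 \<le> length V \<Longrightarrow> reach (Suc n) True (adj_sums V @ [snd * last V])"
| narrow: "reach n b V \<Longrightarrow> 2 \<le> length V \<Longrightarrow> reach (Suc n) (b \<or> 2 < length V) (adj_sums V)"

lemma reach_nonempty: "reach n b V \<Longrightarrow> V \<noteq> []"
  by (induction rule: reach.induct) (auto simp flip: length_greater_0_conv)

text \<open>Dropping an end point amounts to another choice of the last steps or to dropping the
  same end one step earlier: \<open>widen\<close> turns into \<open>up\<close> or
  \<open>right\<close>, and these without their new point turn into \<open>narrow\<close>.\<close>

lemma reach_trim:
  "reach n b V \<Longrightarrow> 3 \<le> length V \<Longrightarrow> reach n True (butlast V) \<and> reach n True (tl V)"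
proof (induction rule: reach.induct)
  case init
  then show ?case by simp
next
  case (widen n b V)
  then have "2 \<le> length V" by simp
  then show ?case
    using reach.up[OF widen.hyps] reach.right[OF widen.hyps] by (simp add: butlast_append)
next
  case (up n b V)
  have V: "3 \<le> length V" using up by simp
  then have ne: "adj_sums V \<noteq> []" and hd: "hd (butlast V) = hd V"
    by (auto simp flip: length_greater_0_conv) (cases V; auto)
  have "reach (Suc n) True (fst * hd (butlast V) # adj_sums (butlast V))"
    using up V by (intro reach.up[of n True]) auto
  moreover have "reach (Suc n) True (adj_sums V)"
    using reach.narrow[OF up.hyps] V by simp
  ultimately show ?case using ne hd by (simp add: adj_sums_butlast)
next
  case (right n b V)
  have V: "3 \<le> length V" using right by simp
  then have ne: "adj_sums V \<noteq> []" and last: "last (tl V) = last V"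
    by (auto simp flip: length_greater_0_conv) (cases V; auto)
  have "reach (Suc n) True (adj_sums (tl V) @ [snd * last (tl V)])"
    using right V by (intro reach.right[of n True]) auto
  moreover have "reach (Suc n) True (adj_sums V)"
    using reach.narrow[OF right.hyps] V by simp
  ultimately show ?case using ne last by (simp add: adj_sums_tl)
next
  case (narrow n b V)
  have V: "4 \<le> length V" using narrow by simp
  have "reach (Suc n) True (adj_sums (butlast V))" "reach (Suc n) True (adj_sums (tl V))"
    using narrow V reach.narrow[of n True "butlast V"] reach.narrow[of n True "tl V"] by auto
  then show ?case by (simp add: adj_sums_butlast adj_sums_tl)
qed

section \<open>The inequality for the recursion\<close>

definition mw_bound :: "plane_fun \<Rightarrow> bool" where
  "mw_bound f \<longleftrightarrow> 0 \<le> f (2, 0) \<and> 0 \<le> f (0, 2) \<and> 0 \<le> f (1, 1) \<and>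
     4 / 3 * (f (1, 1))\<^sup>2 \<le> f (2, 0) * f (0, 2)"

text \<open>Meant for chains of unit squares: the polynomial x + y of one square has the value 2 at
  all three points.\<close>

definition flat :: "plane_fun \<Rightarrow> bool" where
  "flat f \<longleftrightarrow> 0 \<le> f (1, 1) \<and> f (2, 0) = f (1, 1) \<and> f (0, 2) = f (1, 1)"

text \<open>Only the mixed terms need work. The product of the two bounds and the AM-GM inequality
  for \<open>a * b'\<close> and \<open>a' * b\<close> control them; working with squares avoids
  roots.\<close>

lemma product_bound_add:
  fixes a b c :: real
  assumes "0 \<le> a" "0 \<le> b" "0 \<le> c" "0 \<le> a'" "0 \<le> b'" "0 \<le> c'" "0 \<le> k"
    and "k * c\<^sup>2 \<le> a * b" "k * c'\<^sup>2 \<le> a' * b'"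
  shows "k * (c + c')\<^sup>2 \<le> (a + a') * (b + b')"
proof -
  have "(2 * k * c * c')\<^sup>2 = 4 * ((k * c\<^sup>2) * (k * c'\<^sup>2))"
    by (simp add: power2_eq_square)
  also have "\<dots> \<le> 4 * ((a * b) * (a' * b'))"
    using mult_mono[OF assms(8,9)] assms(1-7) by auto
  also have "\<dots> = 4 * (a * b') * (a' * b)" by simp
  also have "\<dots> \<le> (a * b' + a' * b)\<^sup>2"
    using zero_le_power2[of "a * b' - a' * b"] by (simp add: power2_eq_square algebra_simps)
  finally have "2 * k * c * c' \<le> a * b' + a' * b"
    by (rule power2_le_imp_le) (simp add: assms)
  then show ?thesis using assms(8,9) by (simp add: power2_eq_square algebra_simps)
qed

lemma mw_bound_add: "mw_bound f \<Longrightarrow> mw_bound g \<Longrightarrow> mw_bound (f + g)"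
  using product_bound_add[of "f (2,0)" "f (0,2)" "f (1,1)" "g (2,0)" "g (0,2)" "g (1,1)" "4/3"]
  by (simp add: mw_bound_def)

lemma flat_mult: "flat f \<Longrightarrow> flat g \<Longrightarrow> flat (f * g)"
  by (simp add: flat_def)

text \<open>One factor with the constant 4/3 suffices; the other may have the constant 1, as
  \<open>flat\<close> functions do.\<close>

lemma mw_bound_mult_left:
  assumes "0 \<le> f (2, 0)" "0 \<le> f (0, 2)" "0 \<le> f (1, 1)" "(f (1, 1))\<^sup>2 \<le> f (2, 0) * f (0, 2)"
    and "mw_bound g"
  shows "mw_bound (f * g)"
proof -
  have "(f (1, 1))\<^sup>2 * (4 / 3 * (g (1, 1))\<^sup>2) \<le> (f (2, 0) * f (0, 2)) * (g (2, 0) * g (0, 2))"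
    using assms by (intro mult_mono[OF assms(4)]) (auto simp: mw_bound_def)
  then show ?thesis
    using assms by (simp add: mw_bound_def power_mult_distrib mult_ac)
qed

lemma mw_bound_mult:
  assumes "mw_bound f \<or> flat f" "mw_bound g"
  shows "mw_bound (f * g)"
proof (rule mw_bound_mult_left)
  show "(f (1, 1))\<^sup>2 \<le> f (2, 0) * f (0, 2)"
    using assms(1)
  proof
    assume "mw_bound f"
    then show ?thesis using zero_le_power2[of "f (1, 1)"] unfolding mw_bound_def by linarith
  qed (simp add: flat_def power2_eq_square)
qed (use assms in \<open>auto simp: mw_bound_def flat_def\<close>)

section \<open>Snakes: diagrams whose antidiagonals have at most two points\<close>

text \<open>The value at the end of a snake that continues from two points \<open>v\<close> (upper) and \<open>w\<close> (lower)
  with the common steps \<open>\<tau>\<close> of \<open>P\<close> and \<open>Q\<close> and then closes.\<close>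

fun snake :: "step list \<Rightarrow> plane_fun \<Rightarrow> plane_fun \<Rightarrow> plane_fun" where
  "snake [] v w = v + w"
| "snake (North # \<tau>) v w = snake \<tau> (fst * v) (v + w)"
| "snake (East # \<tau>) v w = snake \<tau> (v + w) (snd * w)"

text \<open>Additivity serves to split three points into two overlapping pairs,
  \<open>snake_mult\<close> to take out the value at the point where a snake begins.\<close>

lemma snake_add: "snake \<tau> (v + v') (w + w') = snake \<tau> v w + snake \<tau> v' w'"
proof (induction \<tau> v w arbitrary: v' w' rule: snake.induct)
  case (1 v w)
  show ?case by (simp only: snake.simps add_ac)
next
  case (2 \<tau> v w)
  have "(v + v') + (w + w') = (v + w) + (v' + w')" by (simp only: add_ac)
  then show ?case by (simp only: snake.simps distrib_left 2)
next
  case (3 \<tau> v w)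
  have "(v + v') + (w + w') = (v + w) + (v' + w')" by (simp only: add_ac)
  then show ?case by (simp only: snake.simps distrib_left 3)
qed

lemma snake_mult: "snake \<tau> (u * v) (u * w) = u * snake \<tau> v w"
proof (induction \<tau> v w rule: snake.induct)
  case (1 v w)
  show ?case by (simp only: snake.simps distrib_left)
next
  case (2 \<tau> v w)
  have "fst * (u * v) = u * (fst * v)" by (simp only: mult.left_commute)
  then show ?case by (simp only: snake.simps 2 flip: distrib_left)
next
  case (3 \<tau> v w)
  have "snd * (u * w) = u * (snd * w)" by (simp only: mult.left_commute)
  then show ?case by (simp only: snake.simps 3 flip: distrib_left)
qed

text \<open>The closed value \<open>v + w\<close> is compared with each end point separately. The
  constant 2 is the largest possible: \<open>fst\<close> and \<open>snd\<close> give equality in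
  both inequalities.\<close>

definition snake_inv :: "plane_fun \<Rightarrow> plane_fun \<Rightarrow> bool" where
  "snake_inv v w \<longleftrightarrow> (\<forall>p\<in>{(2,0), (0,2), (1,1)}. 0 \<le> v p \<and> 0 \<le> w p) \<and>
     2 * v (1, 1) * (v + w) (1, 1) \<le> v (2, 0) * (v + w) (0, 2) \<and>
     2 * w (1, 1) * (v + w) (1, 1) \<le> (v + w) (2, 0) * w (0, 2)"

text \<open>Here \<open>a\<close>, \<open>b\<close>, \<open>c\<close> are the values of
  \<open>v\<close> at (2,0), (0,2), (1,1), and the primed ones those of \<open>w\<close>. A North
  step multiplies \<open>v\<close> by x, which doubles \<open>a\<close>, annihilates
  \<open>b\<close> and keeps \<open>c\<close>. The East step is the mirror image.\<close>

lemma snake_step_bounds: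
  fixes a b c a' b' c' :: real
  assumes "0 \<le> a" "0 \<le> b" "0 \<le> c" "0 \<le> a'" "0 \<le> b'" "0 \<le> c'"
    and J: "2 * c * (c + c') \<le> a * (b + b')" and J': "2 * c' * (c + c') \<le> (a + a') * b'"
  shows "2 * c * (c + (c + c')) \<le> 2 * a * (b + b')"
    and "2 * (c + c') * (c + (c + c')) \<le> (2 * a + (a + a')) * (b + b')"
    and "4 / 3 * (c + (c + c'))\<^sup>2 \<le> (2 * a + (a + a')) * (b + b')"
proof -
  have nn: "0 \<le> a * b" "0 \<le> a' * b" "0 \<le> a' * b'" "0 \<le> c * c" "0 \<le> c * c'" "0 \<le> c' * c'"
    using assms by auto
  show "2 * c * (c + (c + c')) \<le> 2 * a * (b + b')"
    using J nn by (simp add: algebra_simps)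
  show K: "2 * (c + c') * (c + (c + c')) \<le> (2 * a + (a + a')) * (b + b')"
    using J J' nn by (simp add: algebra_simps)
  show "4 / 3 * (c + (c + c'))\<^sup>2 \<le> (2 * a + (a + a')) * (b + b')"
  \<comment> \<open>For \<open>c \<le> c'\<close> the factor 4/3 (2c + c') is at most 2 (c + c'),
    and \<open>K\<close> suffices. Otherwise three times \<open>J\<close> yields 6c (c + c') on the
    right, which is enough because c'c' is at most cc and cc'.\<close>
  proof (cases "c \<le> c'")
    case True
    have "4 / 3 * (c + (c + c'))\<^sup>2 = (4 / 3 * (2 * c + c')) * (c + (c + c'))"
      by (simp add: power2_eq_square)
    also have "\<dots> \<le> 2 * (c + c') * (c + (c + c'))"
      using True assms by (intro mult_right_mono) auto
    finally show ?thesis using K by simp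
  next
    case False
    then have "c' * c' \<le> c * c" "c' * c' \<le> c * c'" using assms by (auto intro: mult_mono)
    then show ?thesis using J nn by (simp add: power2_eq_square algebra_simps)
  qed
qed

lemma snake_inv_North:
  assumes "snake_inv v w"
  shows "snake_inv (fst * v) (v + w)" "mw_bound (fst * v + (v + w))"
  using assms snake_step_bounds[of "v (2,0)" "v (0,2)" "v (1,1)" "w (2,0)" "w (0,2)" "w (1,1)"]
  by (auto simp: snake_inv_def mw_bound_def)

lemma snake_inv_East:
  assumes "snake_inv v w"
  shows "snake_inv (v + w) (snd * w)" "mw_bound ((v + w) + snd * w)"
  using assms snake_step_bounds[of "w (0,2)" "w (2,0)" "w (1,1)" "v (0,2)" "v (2,0)" "v (1,1)"]
  by (auto simp: snake_inv_def mw_bound_def mult_ac add_ac)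

text \<open>Closing at once needs the bound as a hypothesis, whereas any further step already
  provides it.\<close>

lemma snake_inv_mw_bound:
  "snake_inv v w \<Longrightarrow> mw_bound (v + w) \<or> \<tau> \<noteq> [] \<Longrightarrow> mw_bound (snake \<tau> v w)"
  by (induction \<tau> v w rule: snake.induct) (auto intro: snake_inv_North snake_inv_East)

lemma snake_initial:
  "if \<tau> = [] then flat (snake \<tau> fst snd) else mw_bound (snake \<tau> fst snd)"
proof -
  have "snake_inv fst snd" by (simp add: snake_inv_def)
  from snake_inv_mw_bound[OF this] show ?thesis by (auto simp: flat_def)
qed

definition verdict :: "bool \<Rightarrow> plane_fun \<Rightarrow> bool" where
  "verdict b f \<longleftrightarrow> (if b then mw_bound f else flat f)"

text \<open>All continuations \<open>\<tau>\<close> are treated together, so that a last step of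
  \<open>reach\<close> can be moved to the front of the snake. The induction is on \<open>n\<close>
  because trimmed lists do not occur in the given derivation.\<close>

lemma reach_verdict:
  assumes "reach n b V"
  shows "(length V = 1 \<longrightarrow> verdict b (V ! 0)) \<and>
    (length V = 2 \<longrightarrow> (\<forall>\<tau>. verdict (b \<or> \<tau> \<noteq> []) (snake \<tau> (V ! 0) (V ! 1))))"
  using assms
proof (induction n arbitrary: b V rule: less_induct)
  case (less n)
  have IH1: "verdict b (W ! 0)" if "m < n" "reach m b W" "length W = 1" for m b W
    using less.IH[OF that(1,2)] that(3) by blast
  have IH2: "verdict (b \<or> \<tau> \<noteq> []) (snake \<tau> (W ! 0) (W ! 1))"
    if "m < n" "reach m b W" "length W = 2" for m b W \<tau>
    using less.IH[OF that(1,2)] that(3) by blast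
  from less.prems show ?case
  proof cases
    case init
    then show ?thesis by (simp add: verdict_def flat_def)
  next
    case (widen m b' W)
    have W: "W \<noteq> []" using widen reach_nonempty by blast
    have "verdict (b \<or> \<tau> \<noteq> []) (snake \<tau> (V ! 0) (V ! 1))" if "length V = 2" for \<tau>
    proof -
      have "length W = 1" using that widen(3) W by (cases W) auto
      then obtain w where w: "W = [w]" by (auto simp: length_Suc_conv)
      have "verdict b' w" using IH1[of m b' W] widen w by simp
      \<comment> \<open>After a single point of value \<open>w\<close> the snake starts afresh from
        x and y, and \<open>w\<close> is a factor.\<close>
      moreover have "snake \<tau> (V ! 0) (V ! 1) = w * snake \<tau> fst snd"
        using widen w snake_mult[of \<tau> w fst snd] by (simp add: mult.commute)
      ultimately show ?thesis
        using snake_initial[of \<tau>] widen w mw_bound_mult[of w "snake \<tau> fst snd"]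
          mw_bound_mult[of "snake \<tau> fst snd" w] flat_mult[of w "snake \<tau> fst snd"]
        by (auto simp: verdict_def mult.commute split: if_splits)
    qed
    moreover have "length V \<noteq> 1" using widen W by simp
    ultimately show ?thesis by blast
  next
    case (up m b' W)
    have "verdict (b \<or> \<tau> \<noteq> []) (snake \<tau> (V ! 0) (V ! 1))" if "length V = 2" for \<tau>
    proof -
      have len: "length W = 2" using that up by simp
      \<comment> \<open>The last step becomes the first step of the snake, which makes its word
        nonempty.\<close>
      then have "verdict True (snake (North # \<tau>) (W ! 0) (W ! 1))"
        using IH2[of m b' W "North # \<tau>"] up by simp
      then show ?thesis
        using up len by (simp add: adj_sums_nth hd_conv_nth flip: length_greater_0_conv)
    qed
    moreover have "length V \<noteq> 1" using up by simp
    ultimately show ?thesis by blast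
  next
    case (right m b' W)
    have "verdict (b \<or> \<tau> \<noteq> []) (snake \<tau> (V ! 0) (V ! 1))" if "length V = 2" for \<tau>
    proof -
      have len: "length W = 2" using that right by simp
      then have "verdict True (snake (East # \<tau>) (W ! 0) (W ! 1))"
        using IH2[of m b' W "East # \<tau>"] right by simp
      then show ?thesis
        using right len by (simp add: adj_sums_nth last_conv_nth nth_append flip: length_greater_0_conv)
    qed
    moreover have "length V \<noteq> 1" using right by simp
    ultimately show ?thesis by blast
  next
    case (narrow m b' W)
    have "verdict b (V ! 0)" if "length V = 1"
    proof -
      have len: "length W = 2" using that narrow by simp
      then have "verdict b' (snake [] (W ! 0) (W ! 1))"
        using IH2[of m b' W "[]"] narrow by simp
      then show ?thesis using narrow len by (simp add: adj_sums_nth)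
    qed
    moreover have "verdict (b \<or> \<tau> \<noteq> []) (snake \<tau> (V ! 0) (V ! 1))" if "length V = 2" for \<tau>
    proof -
      \<comment> \<open>The new pair is the sum of the upper and the lower pair of \<open>W\<close>,
        the middle value being used in both.\<close>
      have len: "length W = 3" using that narrow by simp
      then have "reach m True (butlast W)" "reach m True (tl W)"
        using reach_trim[of m b' W] narrow by auto
      then have "verdict True (snake \<tau> (butlast W ! 0) (butlast W ! 1))"
        "verdict True (snake \<tau> (tl W ! 0) (tl W ! 1))"
        using IH2[of m True "butlast W" \<tau>] IH2[of m True "tl W" \<tau>] narrow len by auto
      then have "mw_bound (snake \<tau> (W ! 0) (W ! 1) + snake \<tau> (W ! 1) (W ! 2))"
        using len by (auto simp: verdict_def nth_butlast nth_tl numeral_2_eq_2 intro!: mw_bound_add)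
      moreover have "V ! 0 = W ! 0 + W ! 1" "V ! 1 = W ! 1 + W ! 2"
        using narrow(3) len by (simp_all add: adj_sums_nth numeral_2_eq_2)
      ultimately have "mw_bound (snake \<tau> (V ! 0) (V ! 1))"
        by (simp only: snake_add)
      then show ?thesis using narrow(2) len by (simp add: verdict_def)
    qed
    ultimately show ?thesis by blast
  qed
qed

section \<open>Heights of lattice paths\<close>

lemma length_eq_count_steps: "length P = count_list P East + count_list P North"
proof (induction P)
  case (Cons s P)
  then show ?case by (cases s) auto
qed simp

definition height :: "path \<Rightarrow> nat \<Rightarrow> nat" where
  "height P i = count_list (take i P) North"

lemma height_0 [simp]: "height P 0 = 0"
  by (simp add: height_def)

lemma height_Suc: "i < length P \<Longrightarrow> height P (Suc i) = height P i + (if P ! i = North then 1 else 0)"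
  by (simp add: height_def take_Suc_conv_app_nth)

lemma height_mono: "i \<le> k \<Longrightarrow> height P i \<le> height P k"
  by (metis height_def count_list_append le_add1 le_add_diff_inverse take_add)

lemma height_le_count: "height P i \<le> count_list P North"
  by (metis append_take_drop_id count_list_append height_def le_add1)

lemma north_steps_snoc:
  "north_steps (P @ [s]) =
     (if s = North then insert (Suc (length P)) (north_steps P) else north_steps P)"
proof -
  have "{1..Suc (length P)} = insert (Suc (length P)) {1..length P}" by auto
  then show ?thesis by (auto simp: north_steps_def nth_append split: if_splits)
qed

lemma finite_north_steps [simp]: "finite (north_steps P)"
  by (simp add: north_steps_def)

lemma sorted_north_steps_snoc:
  "sorted_list_of_set (north_steps (P @ [s])) =
     sorted_list_of_set (north_steps P) @ (if s = North then [Suc (length P)] else [])"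
proof (cases "s = North")
  case True
  have less: "x < Suc (length P)" if "x \<in> north_steps P" for x
    using that by (simp add: north_steps_def)
  then have "sorted_list_of_set (insert (Suc (length P)) (north_steps P)) =
      sorted_list_of_set (north_steps P) @ [Suc (length P)]"
    by (intro sorted_list_of_set_unique[THEN iffD1])
      (auto simp: sorted_wrt_append card_insert_if)
  then show ?thesis using True by (simp add: north_steps_snoc)
qed (simp add: north_steps_snoc)

lemma card_north_steps: "card (north_steps P) = count_list P North"
proof (induction P rule: rev_induct)
  case Nil
  then show ?case by (simp add: north_steps_def)
next
  case (snoc s P)
  have "Suc (length P) \<notin> north_steps P" by (simp add: north_steps_def)
  then show ?case using snoc by (simp add: north_steps_snoc)
qed

text \<open>This translates the intervals of the presentation into heights of the two paths.\<close>

lemma north_pos_le_iff: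
  "k < count_list P North \<Longrightarrow> north_pos P k \<le> i \<longleftrightarrow> k < height P i"
proof (induction P rule: rev_induct)
  case Nil
  then show ?case by simp
next
  case (snoc s P)
  have pos: "north_pos (P @ [s]) k = (if k < count_list P North then north_pos P k
      else Suc (length P))"
    using snoc.prems
    by (auto simp: north_pos_def sorted_north_steps_snoc nth_append card_north_steps
        less_Suc_eq split: if_splits)
  have hgt: "height (P @ [s]) i = (if i \<le> length P then height P i
      else count_list P North + (if s = North then 1 else 0))"
    by (auto simp: height_def)
  show ?case
  proof (cases "k < count_list P North")
    case True
    then show ?thesis using snoc.IH pos hgt by (auto simp: height_def)
  next
    case False
    then show ?thesis using snoc.prems pos hgt height_le_count[of P i] by (auto split: if_splits)
  qed
qed

section \<open>Rank and isomorphism\<close>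

lemma rank_ge:
  assumes "finite A" "X \<in> indep M" "X \<subseteq> A"
  shows "card X \<le> rank M A"
proof -
  have "finite {X \<in> indep M. X \<subseteq> A}"
    by (rule finite_subset[of _ "Pow A"]) (use assms in auto)
  then show ?thesis using assms unfolding rank_def by (intro Max_ge) auto
qed

lemma rank_attained:
  assumes "finite A" "{} \<in> indep M"
  obtains X where "X \<in> indep M" "X \<subseteq> A" "card X = rank M A"
proof -
  have "finite {X \<in> indep M. X \<subseteq> A}"
    by (rule finite_subset[of _ "Pow A"]) (use assms in auto)
  then have "rank M A \<in> card ` {X \<in> indep M. X \<subseteq> A}"
    using assms unfolding rank_def by (intro Max_in) auto
  then show ?thesis using that by auto
qed

lemma rank_image_iso:
  assumes "bij_betw f (ground M) (ground N)"
    and "\<forall>X. X \<subseteq> ground M \<longrightarrow> (X \<in> indep M \<longleftrightarrow> f ` X \<in> indep N)"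
    and "A \<subseteq> ground M"
  shows "rank N (f ` A) = rank M A"
proof -
  have inj: "inj_on f (ground M)" using assms(1) by (rule bij_betw_imp_inj_on)
  have "card ` {Y \<in> indep N. Y \<subseteq> f ` A} = card ` {X \<in> indep M. X \<subseteq> A}"
  proof (intro equalityI subsetI)
    fix c assume "c \<in> card ` {Y \<in> indep N. Y \<subseteq> f ` A}"
    then obtain Y where Y: "Y \<in> indep N" "Y \<subseteq> f ` A" "c = card Y" by auto
    then obtain X where X: "X \<subseteq> A" "Y = f ` X" by (auto simp: subset_image_iff)
    then have "c = card X"
      using Y card_image[OF inj_on_subset[OF inj]] assms(3) by (metis order_trans)
    then show "c \<in> card ` {X \<in> indep M. X \<subseteq> A}" using X Y assms(2,3) by auto
  next
    fix c assume "c \<in> card ` {X \<in> indep M. X \<subseteq> A}"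
    then obtain X where X: "X \<in> indep M" "X \<subseteq> A" "c = card X" by auto
    then have "c = card (f ` X)"
      using card_image[OF inj_on_subset[OF inj]] assms(3) by (metis order_trans)
    then show "c \<in> card ` {Y \<in> indep N. Y \<subseteq> f ` A}" using X assms(2,3) by auto
  qed
  then show ?thesis by (simp add: rank_def)
qed

lemma tutte_iso:
  assumes "matroid_iso M N"
  shows "tutte M x y = tutte N x y"
proof -
  obtain f where f: "bij_betw f (ground M) (ground N)"
    "\<forall>X. X \<subseteq> ground M \<longrightarrow> (X \<in> indep M \<longleftrightarrow> f ` X \<in> indep N)"
    using assms by (auto simp: matroid_iso_def)
  have inj: "inj_on f (ground M)" and img: "f ` ground M = ground N"
    using f(1) by (auto simp: bij_betw_def)
  have "rank N (f ` A) = rank M A" "card (f ` A) = card A" if "A \<in> Pow (ground M)" for A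
    using that rank_image_iso[OF f] card_image[OF inj_on_subset[OF inj]] by auto
  moreover have "rank N (ground N) = rank M (ground M)"
    using rank_image_iso[OF f subset_refl] img by simp
  moreover have "Pow (ground N) = image f ` Pow (ground M)"
    using img by (simp flip: image_Pow_surj)
  ultimately show ?thesis
    by (simp add: tutte_def sum.reindex[OF inj_on_image_Pow[OF inj]])
qed

lemma matroid_iso_trans: "matroid_iso M N \<Longrightarrow> matroid_iso N K \<Longrightarrow> matroid_iso M K"
  unfolding matroid_iso_def
proof (elim exE conjE)
  fix f g
  assume f: "bij_betw f (ground M) (ground N)"
    "\<forall>X. X \<subseteq> ground M \<longrightarrow> (X \<in> indep M \<longleftrightarrow> f ` X \<in> indep N)"
    and g: "bij_betw g (ground N) (ground K)"
    "\<forall>X. X \<subseteq> ground N \<longrightarrow> (X \<in> indep N \<longleftrightarrow> g ` X \<in> indep K)"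
  show "\<exists>h. bij_betw h (ground M) (ground K) \<and>
    (\<forall>X. X \<subseteq> ground M \<longrightarrow> (X \<in> indep M \<longleftrightarrow> h ` X \<in> indep K))"
  proof (intro exI[of _ "g \<circ> f"] conjI allI impI)
    show "bij_betw (g \<circ> f) (ground M) (ground K)" using f(1) g(1) by (rule bij_betw_trans)
    fix X assume X: "X \<subseteq> ground M"
    then have "f ` X \<subseteq> ground N" using f(1) by (auto simp: bij_betw_def)
    then show "X \<in> indep M \<longleftrightarrow> (g \<circ> f) ` X \<in> indep K"
      using f(2) g(2) X by (simp add: image_comp)
  qed
qed

lemma iso_loop:
  assumes "matroid_iso M N" "is_loop N e"
  shows "\<exists>e. is_loop M e"
proof -
  obtain f where f: "bij_betw f (ground M) (ground N)"
    "\<forall>X. X \<subseteq> ground M \<longrightarrow> (X \<in> indep M \<longleftrightarrow> f ` X \<in> indep N)"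
    using assms by (auto simp: matroid_iso_def)
  obtain d where "d \<in> ground M" "f d = e"
    using assms(2) f(1) by (metis is_loop_def bij_betw_def imageE)
  then show ?thesis using f(2)[rule_format, of "{d}"] assms(2) by (auto simp: is_loop_def)
qed

text \<open>Assuming that \<open>e\<close> extends every independent set lets the property pass
  through the isomorphism without mentioning bases of \<open>N\<close>.\<close>

lemma iso_coloop:
  assumes "matroid M" "matroid_iso M N" "e \<in> ground N"
    and "\<And>X. X \<in> indep N \<Longrightarrow> insert e X \<in> indep N"
  shows "\<exists>e. is_coloop M e"
proof -
  interpret matroid M by fact
  obtain f where f: "bij_betw f (ground M) (ground N)"
    "\<forall>X. X \<subseteq> ground M \<longrightarrow> (X \<in> indep M \<longleftrightarrow> f ` X \<in> indep N)"
    using assms by (auto simp: matroid_iso_def)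
  obtain d where d: "d \<in> ground M" "f d = e"
    using assms(3) f(1) by (metis bij_betw_def imageE)
  have "d \<in> B" if "basis M B" for B
  proof -
    have B: "B \<in> indep M" "B \<subseteq> ground M"
      using that indep_subset_ground by (auto simp: basis_def)
    then have "insert d B \<in> indep M"
      using f(2)[rule_format, of B] f(2)[rule_format, of "insert d B"] assms(4) d by auto
    then show ?thesis using that by (auto simp: basis_def)
  qed
  then show ?thesis using d(1) by (auto simp: is_coloop_def)
qed

section \<open>Truncations of a lattice path matroid\<close>

locale path_pair =
  fixes P Q :: path
  assumes length_eq: "length Q = length P"
    and count_eq: "count_list Q North = count_list P North"
    and below: "never_above P Q"
begin

abbreviation "n \<equiv> length P"
abbreviation "r \<equiv> count_list P North"

lemma height_below: "height P i \<le> height Q i"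
  using below by (simp add: never_above_def height_def)

lemma height_Q_le: "height Q i \<le> r"
  using height_le_count[of Q i] count_eq by simp

text \<open>Only the rows are truncated; the cut after \<open>i\<close> steps is made by taking
  ranks of subsets of \<open>{1..i}\<close>.\<close>

definition first_rows :: "nat \<Rightarrow> nat indep_system" where
  "first_rows j = transversal_matroid {1..n} {..<j} (\<lambda>i. {north_pos Q i..north_pos P i})"

text \<open>A matching into the first \<open>j\<close> rows, with membership in a row expressed by
  heights as in \<open>mem_row_iff\<close>.\<close>

definition matches :: "nat \<Rightarrow> nat set \<Rightarrow> (nat \<Rightarrow> nat) \<Rightarrow> bool" where
  "matches j X \<phi> \<longleftrightarrow> X \<subseteq> {1..n} \<and> inj_on \<phi> X \<and>
     (\<forall>x\<in>X. \<phi> x < j \<and> height P (x - 1) \<le> \<phi> x \<and> \<phi> x < height Q x)"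

lemma lpm_eq_first_rows: "lpm P Q = first_rows r"
  by (simp add: lpm_def first_rows_def)

lemma mem_row_iff:
  assumes "k < r" "1 \<le> x"
  shows "x \<in> {north_pos Q k..north_pos P k} \<longleftrightarrow> height P (x - 1) \<le> k \<and> k < height Q x"
  using north_pos_le_iff[of k Q x] north_pos_le_iff[of k P "x - 1"] assms count_eq by auto

lemma indep_first_rows_iff:
  assumes "j \<le> r"
  shows "X \<in> indep (first_rows j) \<longleftrightarrow> (\<exists>\<phi>. matches j X \<phi>)"
proof -
  have "(X \<subseteq> {1..n} \<and> inj_on \<phi> X \<and> \<phi> ` X \<subseteq> {..<j} \<and>
      (\<forall>x\<in>X. x \<in> {north_pos Q (\<phi> x)..north_pos P (\<phi> x)})) \<longleftrightarrow> matches j X \<phi>" for \<phi>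
    unfolding matches_def image_subset_iff lessThan_iff
    using mem_row_iff[of "\<phi> _" _] assms
    by (smt (verit) atLeastAtMost_iff order_less_le_trans subsetD)
  then show ?thesis by (auto simp: first_rows_def transversal_matroid_def)
qed

lemma empty_indep: "{} \<in> indep (first_rows j)"
  by (simp add: first_rows_def transversal_matroid_def)

lemma indep_first_rows_card:
  assumes "j \<le> r" "X \<in> indep (first_rows j)"
  shows "card X \<le> j"
proof -
  obtain \<phi> where "matches j X \<phi>" using assms by (auto simp: indep_first_rows_iff)
  then have "card X \<le> card {..<j}" by (intro card_inj_on_le[of \<phi>]) (auto simp: matches_def)
  then show ?thesis by simp
qed

lemma rank_first_rows_le:
  assumes "finite A" "j \<le> r"
  shows "rank (first_rows j) A \<le> j" "rank (first_rows j) A \<le> card A"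
proof -
  obtain X where X: "X \<in> indep (first_rows j)" "X \<subseteq> A" "card X = rank (first_rows j) A"
    using rank_attained[OF assms(1) empty_indep] by metis
  show "rank (first_rows j) A \<le> j" using X indep_first_rows_card[OF assms(2)] by metis
  show "rank (first_rows j) A \<le> card A" using X card_mono[OF assms(1)] by metis
qed

text \<open>Contraction of \<open>Suc i\<close>, which lies in the last row \<open>j\<close>.
  Matching it there adds one to the rank; conversely, giving up row \<open>j\<close> costs a
  matching at most one element, namely \<open>Suc i\<close> itself if it is used.\<close>

lemma rank_insert_next:
  assumes "i < n" "A \<subseteq> {1..i}" "height P i \<le> j" "j < height Q (Suc i)"
  shows "rank (first_rows (Suc j)) (insert (Suc i) A) = Suc (rank (first_rows j) A)"
proof (rule antisym)
  have jr: "Suc j \<le> r" using assms(4) height_Q_le[of "Suc i"] by linarith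
  have fin: "finite A" using assms(2) finite_subset by blast
  have new: "Suc i \<notin> A" using assms(2) by auto
  obtain X where X: "X \<in> indep (first_rows j)" "X \<subseteq> A" "card X = rank (first_rows j) A"
    using rank_attained[OF fin empty_indep] by metis
  obtain \<phi> where "matches j X \<phi>" using X(1) jr by (auto simp: indep_first_rows_iff)
  then have "matches (Suc j) (insert (Suc i) X) (\<phi>(Suc i := j))"
    using X(2) new assms unfolding matches_def inj_on_def by (auto simp: less_Suc_eq)
  then have "insert (Suc i) X \<in> indep (first_rows (Suc j))"
    using jr by (auto simp: indep_first_rows_iff)
  then have "card (insert (Suc i) X) \<le> rank (first_rows (Suc j)) (insert (Suc i) A)"
    using X(2) fin by (intro rank_ge) auto
  moreover have "card (insert (Suc i) X) = Suc (card X)"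
    using X(2) new finite_subset[OF X(2) fin] by (auto simp: card_insert_if)
  ultimately show "Suc (rank (first_rows j) A) \<le> rank (first_rows (Suc j)) (insert (Suc i) A)"
    using X(3) by simp
next
  have jr: "Suc j \<le> r" using assms(4) height_Q_le[of "Suc i"] by linarith
  have fin: "finite A" using assms(2) finite_subset by blast
  obtain X where X: "X \<in> indep (first_rows (Suc j))" "X \<subseteq> insert (Suc i) A"
    "card X = rank (first_rows (Suc j)) (insert (Suc i) A)"
    using rank_attained[OF _ empty_indep, of "insert (Suc i) A"] fin by (metis finite_insert)
  obtain \<phi> where \<phi>: "matches (Suc j) X \<phi>" using X(1) jr by (auto simp: indep_first_rows_iff)
  have finX: "finite X" using X(2) fin finite_subset by blast
  have "\<exists>Y \<psi>. Y \<subseteq> A \<and> matches j Y \<psi> \<and> card X \<le> Suc (card Y)"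
  proof (cases "Suc i \<in> X")
    case True
    \<comment> \<open>An element matched to the last row \<open>j\<close> also lies in the row of \<open>Suc i\<close>, which becomes free.\<close>
    define \<psi> where "\<psi> x = (if \<phi> x = j then \<phi> (Suc i) else \<phi> x)" for x
    have inj: "x = y" if "x \<in> X" "y \<in> X" "\<phi> x = \<phi> y" for x y
      using \<phi> that by (auto simp: matches_def inj_on_def)
    have "matches j (X - {Suc i}) \<psi>"
      unfolding matches_def
    proof (intro conjI ballI)
      show "X - {Suc i} \<subseteq> {1..n}" using \<phi> by (auto simp: matches_def)
      show "inj_on \<psi> (X - {Suc i})"
        using inj True by (auto simp: inj_on_def \<psi>_def split: if_splits)
      fix x assume x: "x \<in> X - {Suc i}"
      then have "\<phi> x \<noteq> \<phi> (Suc i)" using inj True by blast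
      moreover have "x \<le> i" using x X(2) assms(2) by auto
      then have "height P (x - 1) \<le> height P i" by (intro height_mono) auto
      moreover have "height P i \<le> \<phi> (Suc i)" "\<phi> (Suc i) < Suc j"
        using \<phi> True by (auto simp: matches_def)
      moreover have "\<phi> x < Suc j" "height P (x - 1) \<le> \<phi> x" "\<phi> x < height Q x"
        using \<phi> x by (auto simp: matches_def)
      ultimately show "\<psi> x < j" "height P (x - 1) \<le> \<psi> x" "\<psi> x < height Q x"
        by (auto simp: \<psi>_def)
    qed
    moreover have "card X = Suc (card (X - {Suc i}))"
      using finX True by (rule card.remove)
    ultimately show ?thesis using X(2) by (intro exI[of _ "X - {Suc i}"] exI[of _ \<psi>]) auto
  next
    case False
    define Y where "Y = {x \<in> X. \<phi> x \<noteq> j}"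
    have "matches j Y \<phi>" using \<phi> by (auto simp: matches_def Y_def inj_on_def less_Suc_eq)
    moreover have "card (X - Y) \<le> card {j}"
      by (rule card_inj_on_le[of \<phi>]) (use \<phi> in \<open>auto simp: matches_def Y_def inj_on_def\<close>)
    then have "card X \<le> Suc (card Y)"
      using finX card_Diff_subset[of Y X] by (auto simp: Y_def)
    ultimately show ?thesis using X(2) False by (intro exI[of _ Y] exI[of _ \<phi>]) (auto simp: Y_def)
  qed
  then obtain Y \<psi> where Y: "Y \<subseteq> A" "matches j Y \<psi>" "card X \<le> Suc (card Y)" by blast
  have "Y \<in> indep (first_rows j)" using Y(2) jr by (auto simp: indep_first_rows_iff)
  then have "card Y \<le> rank (first_rows j) A" using fin Y(1) by (intro rank_ge)
  then show "rank (first_rows (Suc j)) (insert (Suc i) A) \<le> Suc (rank (first_rows j) A)"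
    using X(3) Y(3) by linarith
qed

text \<open>Row \<open>j\<close> starts only after step \<open>i\<close>, so no element of
  \<open>A\<close> can be matched to it.\<close>

lemma rank_above:
  assumes "A \<subseteq> {1..i}" "height Q i \<le> j" "Suc j \<le> r"
  shows "rank (first_rows (Suc j)) A = rank (first_rows j) A"
proof -
  have "matches (Suc j) X \<phi> \<longleftrightarrow> matches j X \<phi>" if "X \<subseteq> A" for X \<phi>
  proof -
    have "height Q x \<le> j" if "x \<in> X" for x
      using height_mono[of x i Q] assms(1,2) that \<open>X \<subseteq> A\<close> by force
    then show ?thesis unfolding matches_def by (meson less_SucI order_less_le_trans)
  qed
  then have "{X \<in> indep (first_rows (Suc j)). X \<subseteq> A} = {X \<in> indep (first_rows j). X \<subseteq> A}"
    using assms(3) by (auto simp: indep_first_rows_iff)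
  then show ?thesis by (simp add: rank_def)
qed

text \<open>The first \<open>j\<close> rows all end before \<open>Suc i\<close>, which is therefore
  a loop.\<close>

lemma rank_insert_below:
  assumes "j \<le> height P i"
  shows "rank (first_rows j) (insert (Suc i) A) = rank (first_rows j) A"
proof -
  have "Suc i \<notin> X" if "X \<in> indep (first_rows j)" for X
    using that assms height_le_count[of P i] indep_first_rows_iff[of j X]
    by (force simp: matches_def)
  then have "{X \<in> indep (first_rows j). X \<subseteq> insert (Suc i) A} = {X \<in> indep (first_rows j). X \<subseteq> A}"
    by auto
  then show ?thesis by (simp add: rank_def)
qed

text \<open>Either \<open>Suc i\<close> is a loop met on the bottom path, or the point is preceded
  by one a row lower, from which \<open>rank_insert_next\<close> adds one.\<close>

lemma rank_prefix:
  "i \<le> n \<Longrightarrow> height P i \<le> j \<Longrightarrow> j \<le> height Q i \<Longrightarrow> rank (first_rows j) {1..i} = j"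
proof (induction i arbitrary: j)
  case 0
  then show ?case using rank_first_rows_le[of "{}" 0] by simp
next
  case (Suc i)
  have ins: "{1..Suc i} = insert (Suc i) {1..i}" by auto
  show ?case
  proof (cases "j \<le> height P i")
    case True
    then show ?thesis
      using Suc height_mono[of i "Suc i" P] height_below[of i] rank_insert_below[OF True]
      unfolding ins by simp
  next
    case False
    then obtain k where k: "j = Suc k" "height P i \<le> k" by (cases j) auto
    moreover have "k \<le> height Q i"
      using k Suc.prems height_Suc[of i Q] length_eq by (auto split: if_splits)
    ultimately show ?thesis
      using Suc rank_insert_next[of i "{1..i}" k] unfolding ins by simp
  qed
qed

section \<open>Deletion and contraction for the Tutte polynomials of truncations\<close>

text \<open>The Tutte polynomial of the truncation at height \<open>j\<close> on the \<open>i\<close>-th antidiagonal, whose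
  matroid is the restriction of \<open>first_rows j\<close> to \<open>{1..i}\<close>, of rank \<open>j\<close> if the point is in the diagram.\<close>

definition tutte_at :: "nat \<Rightarrow> nat \<Rightarrow> plane_fun" where
  "tutte_at i j = (\<lambda>(x, y). \<Sum>A\<in>Pow {1..i}.
     (x - 1) ^ (j - rank (first_rows j) A) * (y - 1) ^ (card A - rank (first_rows j) A))"

lemma tutte_at_Suc: "tutte_at (Suc i) j (x, y) = tutte_at i j (x, y) + (\<Sum>A\<in>Pow {1..i}.
    (x - 1) ^ (j - rank (first_rows j) (insert (Suc i) A)) *
    (y - 1) ^ (Suc (card A) - rank (first_rows j) (insert (Suc i) A)))"
proof -
  have ins: "{1..Suc i} = insert (Suc i) {1..i}" by auto
  have inj: "inj_on (insert (Suc i)) (Pow {1..i})"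
    by (rule inj_onI) (auto dest!: insert_ident[THEN iffD1, rotated 2])
  have card: "card (insert (Suc i) A) = Suc (card A)" if "A \<in> Pow {1..i}" for A
    using that finite_subset[of A "{1..i}"] by (auto simp: card_insert_if)
  show ?thesis
    unfolding tutte_at_def ins Pow_insert prod.case
  proof (subst sum.union_disjoint)
    show "Pow {1..i} \<inter> insert (Suc i) ` Pow {1..i} = {}" by force
  qed (simp_all only: sum.reindex[OF inj] card comp_def finite_Pow_iff finite_imageI
      finite_atLeastAtMost cong: sum.cong)
qed

text \<open>Subsets without \<open>Suc i\<close> give the deletion. Those with it give the
  contraction, since rank and cardinality both grow by one and the exponents stay the same. The
  deletion term may belong to a point just above the diagram.\<close>

lemma tutte_at_interior:
  assumes "i < n" "height P i \<le> j" "j < height Q (Suc i)"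
  shows "tutte_at (Suc i) (Suc j) = tutte_at i (Suc j) + tutte_at i j"
proof (rule ext, clarify)
  fix x y
  show "tutte_at (Suc i) (Suc j) (x, y) = (tutte_at i (Suc j) + tutte_at i j) (x, y)"
    using assms rank_insert_next[OF assms(1) _ assms(2,3)]
    by (simp add: tutte_at_Suc) (simp add: tutte_at_def)
qed

text \<open>Above the diagram the formula exceeds the rank and each term gains a factor x - 1; the
  contraction term in \<open>tutte_at_top\<close> completes it to x.\<close>

lemma tutte_at_above:
  assumes "height Q i \<le> j" "Suc j \<le> r"
  shows "tutte_at i (Suc j) (x, y) = (x - 1) * tutte_at i j (x, y)"
proof -
  have "Suc j - rank (first_rows (Suc j)) A = Suc (j - rank (first_rows j) A)"
    "card A - rank (first_rows (Suc j)) A = card A - rank (first_rows j) A"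
    if "A \<in> Pow {1..i}" for A
    using that rank_above[OF _ assms, of A] rank_first_rows_le(1)[of A j] assms(2)
      finite_subset[of A "{1..i}"] by auto
  then show ?thesis by (simp add: tutte_at_def sum_distrib_left mult_ac)
qed

lemma tutte_at_top:
  assumes "i < n" "Q ! i = North"
  shows "tutte_at (Suc i) (Suc (height Q i)) = fst * tutte_at i (height Q i)"
proof (rule ext, clarify)
  fix x y
  have "height Q i < height Q (Suc i)" using assms height_Suc[of i Q] length_eq by simp
  moreover from this have "Suc (height Q i) \<le> r" using height_Q_le[of "Suc i"] by simp
  ultimately show "tutte_at (Suc i) (Suc (height Q i)) (x, y) = (fst * tutte_at i (height Q i)) (x, y)"
    using tutte_at_interior[OF assms(1) height_below] tutte_at_above[of i "height Q i" x y]
    by (simp add: algebra_simps)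
qed

text \<open>Here \<open>Suc i\<close> is a loop: adding it raises only the nullity, which gives the
  factor 1 + (y - 1).\<close>

lemma tutte_at_bottom: "tutte_at (Suc i) (height P i) = snd * tutte_at i (height P i)"
proof (rule ext, clarify)
  fix x y
  have "Suc (card A) - rank (first_rows (height P i)) A =
      Suc (card A - rank (first_rows (height P i)) A)" if "A \<in> Pow {1..i}" for A
    using that rank_first_rows_le(2)[of A "height P i"] height_le_count[of P i]
      finite_subset[of A "{1..i}"] by auto
  then show "tutte_at (Suc i) (height P i) (x, y) = (snd * tutte_at i (height P i)) (x, y)"
    by (simp add: tutte_at_Suc rank_insert_below)
      (simp add: tutte_at_def sum_distrib_left algebra_simps sum_subtractf)
qed

lemma tutte_at_end: "tutte_at n r (x, y) = tutte (lpm P Q) x y"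
proof -
  have "height P n = r" "height Q n = r" using length_eq count_eq by (simp_all add: height_def)
  then have "rank (first_rows r) {1..n} = r" by (intro rank_prefix) auto
  moreover have "ground (lpm P Q) = {1..n}" by (simp add: lpm_def transversal_matroid_def)
  ultimately show ?thesis by (simp add: tutte_def tutte_at_def lpm_eq_first_rows)
qed

section \<open>Antidiagonals of a pair of paths as instances of \<open>reach\<close>\<close>

definition antidiag :: "nat \<Rightarrow> plane_fun list" where
  "antidiag i = map (tutte_at i) (rev [height P i..<Suc (height Q i)])"

lemma length_antidiag: "length (antidiag i) = Suc (height Q i) - height P i"
  using height_below[of i] by (simp add: antidiag_def)

lemma antidiag_0: "antidiag 0 = [1]"
  using rank_first_rows_le[of "{}" 0] by (auto simp: antidiag_def tutte_at_def)

text \<open>Inner points have two predecessors. A North step of \<open>Q\<close> adds a top point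
  and an East step of \<open>P\<close> a bottom point, each with a single predecessor in the
  diagram.\<close>

lemma antidiag_Suc:
  assumes "i < n"
  shows "antidiag (Suc i) =
    (if Q ! i = North then [fst * hd (antidiag i)] else []) @ adj_sums (antidiag i) @
    (if P ! i = East then [snd * last (antidiag i)] else [])"
proof -
  let ?l = "height P i" and ?h = "height Q i"
  have lh: "?l \<le> ?h" by (rule height_below)
  have h': "height Q (Suc i) = (if Q ! i = North then Suc ?h else ?h)"
    using height_Suc[of i Q] assms length_eq by simp
  have l': "height P (Suc i) = (if P ! i = East then ?l else Suc ?l)"
    using height_Suc[of i P] assms by (cases "P ! i") auto
  have "adj_sums (antidiag i) = map (tutte_at (Suc i)) (rev [Suc ?l..<Suc ?h])"
    unfolding antidiag_def
    using tutte_at_interior[OF assms] height_mono[of i "Suc i" Q]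
    by (intro adj_sums_rev_upt lh) auto
  moreover have "fst * hd (antidiag i) = tutte_at (Suc i) (Suc ?h)" if "Q ! i = North"
    using tutte_at_top[OF assms that] lh by (simp add: antidiag_def)
  moreover have "snd * last (antidiag i) = tutte_at (Suc i) ?l"
    using tutte_at_bottom[of i] lh
    by (simp add: antidiag_def last_rev last_map upt_conv_Cons del: upt_Suc)
  moreover have "[?l..<Suc ?h] = ?l # [Suc ?l..<Suc ?h]"
    using lh by (simp add: upt_conv_Cons del: upt_Suc)
  moreover have "[?l..<Suc (Suc ?h)] = ?l # [Suc ?l..<Suc ?h] @ [Suc ?h]"
    "[Suc ?l..<Suc (Suc ?h)] = [Suc ?l..<Suc ?h] @ [Suc ?h]"
    using lh by (simp_all add: upt_conv_Cons)
  ultimately show ?thesis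
    unfolding antidiag_def[of "Suc i"] h' l' by (simp del: upt_Suc)
qed

text \<open>The paths NENE... and ENEN... that bound a chain of unit squares, up to step
  \<open>i\<close>.\<close>

definition alternating :: "nat \<Rightarrow> bool" where
  "alternating i \<longleftrightarrow> (\<forall>k<i. Q ! k = (if even k then North else East) \<and>
     P ! k = (if even k then East else North))"

text \<open>Common steps occur only where the paths are apart, so \<open>up\<close> and
  \<open>right\<close> find two points. A false flag leaves only the alternating paths.\<close>

lemma antidiag_reach:
  assumes no_common: "\<And>i. i < n \<Longrightarrow> height P i = height Q i \<Longrightarrow> P ! i \<noteq> Q ! i"
  shows "i \<le> n \<Longrightarrow> \<exists>b. reach i b (antidiag i) \<and>
    (\<not> b \<longrightarrow> alternating i \<and> length (antidiag i) = Suc (i mod 2))"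
proof (induction i)
  case 0
  then show ?case using reach.init by (auto simp: antidiag_0 alternating_def)
next
  case (Suc i)
  then obtain b where b: "reach i b (antidiag i)"
    "\<not> b \<longrightarrow> alternating i \<and> length (antidiag i) = Suc (i mod 2)" by auto
  have i: "i < n" using Suc by simp
  have two: "2 \<le> length (antidiag i)" if "P ! i = Q ! i"
    using no_common[OF i] that height_below[of i]
    by (cases "height P i = height Q i") (auto simp: length_antidiag)
  show ?case
  proof (cases "Q ! i"; cases "P ! i")
    assume QP: "Q ! i = North" "P ! i = North"
    then show ?thesis using reach.up[OF b(1) two] antidiag_Suc[OF i] by auto
  next
    assume QP: "Q ! i = East" "P ! i = East"
    then show ?thesis using reach.right[OF b(1) two] antidiag_Suc[OF i] by auto
  next
    assume QP: "Q ! i = North" "P ! i = East"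
    have "alternating (Suc i) \<and> length (antidiag (Suc i)) = Suc (Suc i mod 2)"
      if "\<not> (b \<or> 1 < length (antidiag i))"
    proof -
      have "even i" "length (antidiag i) = 1" using that b(2) by (auto simp: even_iff_mod_2_eq_zero)
      then show ?thesis
        using that b(2) QP antidiag_Suc[OF i] by (auto simp: alternating_def less_Suc_eq mod_Suc)
    qed
    then show ?thesis using reach.widen[OF b(1)] antidiag_Suc[OF i] QP by auto
  next
    assume QP: "Q ! i = East" "P ! i = North"
    have "height P i < height Q i"
      using height_below[of "Suc i"] height_Suc[of i P] height_Suc[of i Q] QP i length_eq by simp
    then have len: "2 \<le> length (antidiag i)" by (simp add: length_antidiag)
    have "alternating (Suc i) \<and> length (antidiag (Suc i)) = Suc (Suc i mod 2)"
      if "\<not> (b \<or> 2 < length (antidiag i))"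
    proof -
      have "odd i" "length (antidiag i) = 2" using that b(2) len by (auto simp: odd_iff_mod_2_eq_one)
      then show ?thesis
        using that b(2) QP antidiag_Suc[OF i]
        by (auto simp: alternating_def less_Suc_eq mod_Suc odd_iff_mod_2_eq_one)
    qed
    then show ?thesis using reach.narrow[OF b(1) len] antidiag_Suc[OF i] QP by auto
  qed
qed

lemma tutte_bound:
  assumes no_common: "\<And>i. i < n \<Longrightarrow> height P i = height Q i \<Longrightarrow> P ! i \<noteq> Q ! i"
    and "\<not> (even n \<and> alternating n)"
  shows "4 / 3 * (tutte (lpm P Q) 1 1)\<^sup>2 \<le> tutte (lpm P Q) 2 0 * tutte (lpm P Q) 0 2"
proof -
  obtain b where b: "reach n b (antidiag n)"
    "\<not> b \<longrightarrow> alternating n \<and> length (antidiag n) = Suc (n mod 2)"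
    using antidiag_reach[OF no_common, of n] by auto
  have "height P n = r" "height Q n = r" using length_eq count_eq by (simp_all add: height_def)
  then have last_pt: "antidiag n = [tutte_at n r]" by (simp add: antidiag_def)
  \<comment> \<open>A single point forces \<open>n\<close> to be even, so a false flag would give
    the excluded alternating paths.\<close>
  with b assms(2) have b by (auto simp: even_iff_mod_2_eq_zero)
  then have "mw_bound (tutte_at n r)"
    using reach_verdict[OF b(1)] last_pt by (simp add: verdict_def)
  then show ?thesis by (simp add: mw_bound_def tutte_at_end)
qed

section \<open>Loops and coloops from common steps\<close>

lemma common_East_loop:
  assumes "i < n" "height P i = height Q i" "P ! i = East" "Q ! i = East"
  shows "is_loop (lpm P Q) (Suc i)"
proof -
  have "height Q (Suc i) = height Q i" using assms height_Suc[of i Q] length_eq by simp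
  then have "{Suc i} \<notin> indep (lpm P Q)"
    using assms by (auto simp: lpm_eq_first_rows indep_first_rows_iff matches_def)
  then show ?thesis using assms(1) by (simp add: is_loop_def lpm_def transversal_matroid_def)
qed

text \<open>The row \<open>height P i\<close> consists of \<open>Suc i\<close> alone, so no other
  element competes for it.\<close>

lemma common_North_extends:
  assumes "i < n" "height P i = height Q i" "P ! i = North" "Q ! i = North"
    and "X \<in> indep (lpm P Q)"
  shows "insert (Suc i) X \<in> indep (lpm P Q)"
proof -
  let ?h = "height P i"
  obtain \<phi> where \<phi>: "matches r X \<phi>"
    using assms(5) by (auto simp: lpm_eq_first_rows indep_first_rows_iff)
  have h: "height P (Suc i) = Suc ?h" "height Q (Suc i) = Suc ?h"
    using assms height_Suc[of i P] height_Suc[of i Q] length_eq by auto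
  have "\<phi> x \<noteq> ?h" if "x \<in> X" "x \<noteq> Suc i" for x
  proof (cases "x \<le> i")
    case True
    then have "height Q x \<le> ?h" using height_mono[OF True, of Q] assms(2) by simp
    then show ?thesis using \<phi> that by (auto simp: matches_def)
  next
    case False
    then have "height P (Suc i) \<le> height P (x - 1)" using that by (intro height_mono) auto
    then show ?thesis using \<phi> that h by (auto simp: matches_def)
  qed
  then have "matches r (insert (Suc i) X) (\<phi>(Suc i := ?h))"
    using \<phi> assms(1) h height_le_count[of P "Suc i"] unfolding matches_def inj_on_def
    by (auto; metis)
  then show ?thesis by (auto simp: lpm_eq_first_rows indep_first_rows_iff)
qed

section \<open>Chains of unit squares as sums of trivial snakes\<close>

lemma height_alternating:
  assumes "alternating n"
  shows "i \<le> n \<Longrightarrow> height P i = i div 2 \<and> height Q i = Suc i div 2"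
proof (induction i)
  case (Suc i)
  then show ?case
    using assms height_Suc[of i P] height_Suc[of i Q] length_eq
    by (auto simp: alternating_def elim: evenE oddE)
qed simp

text \<open>The rows are the disjoint pairs 2k + 1, 2k + 2, so a matching is forced to be
  \<open>(x - 1) div 2\<close>.\<close>

lemma indep_alternating:
  assumes "alternating n"
  shows "X \<in> indep (lpm P Q) \<longleftrightarrow> X \<subseteq> {1..n} \<and> inj_on (\<lambda>x. (x - 1) div 2) X"
proof -
  have val: "height P (x - 1) = (x - 1) div 2" "height Q x = Suc ((x - 1) div 2)" if "x \<in> {1..n}" for x
    using height_alternating[OF assms, of x] height_alternating[OF assms, of "x - 1"] that
    by auto
  have "(\<exists>\<phi>. matches r X \<phi>) \<longleftrightarrow> X \<subseteq> {1..n} \<and> inj_on (\<lambda>x. (x - 1) div 2) X" (is "?L \<longleftrightarrow> ?R")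
  proof
    assume ?L
    then obtain \<phi> where \<phi>: "matches r X \<phi>" by blast
    then have "\<phi> x = (x - 1) div 2" if "x \<in> X" for x
      using that val[of x] by (force simp: matches_def)
    then show ?R using \<phi> inj_on_cong[of X \<phi> "\<lambda>x. (x - 1) div 2"] by (auto simp: matches_def)
  next
    assume R: ?R
    have "(x - 1) div 2 < r" if "x \<in> X" for x
      using val[of x] R that height_Q_le[of x] by auto
    then have "matches r X (\<lambda>x. (x - 1) div 2)" using R val by (auto simp: matches_def)
    then show ?L by blast
  qed
  then show ?thesis by (simp add: lpm_eq_first_rows indep_first_rows_iff)
qed

end

lemma indep_trivial_snake: "X \<in> indep trivial_snake \<longleftrightarrow> X \<subseteq> {1..2} \<and> (\<forall>x\<in>X. \<forall>y\<in>X. x = y)"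
proof -
  interpret path_pair "[East, North]" "[North, East]"
    by unfold_locales (auto simp: never_above_def take_Cons split: nat.splits)
  have "alternating 2" by (auto simp: alternating_def less_Suc_eq numeral_2_eq_2)
  then have "alternating (length [East, North])" by (simp add: numeral_2_eq_2)
  note indep = indep_alternating[OF this, of X]
  have "inj_on (\<lambda>x. (x - 1) div 2) X \<longleftrightarrow> (\<forall>x\<in>X. \<forall>y\<in>X. x = y)" if "X \<subseteq> {1..2}"
  proof -
    have "(x - 1) div 2 = 0" if "x \<in> X" for x using \<open>X \<subseteq> {1..2}\<close> that by force
    then show ?thesis by (simp add: inj_on_def)
  qed
  then show ?thesis using indep unfolding trivial_snake_def by (auto simp: numeral_2_eq_2)
qed

lemma (in path_pair) alternating_iso:
  assumes "even n" "alternating n"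
  shows "sum_of_trivial_snakes (lpm P Q)"
proof -
  obtain k where k: "n = 2 * k" using assms(1) by blast
  \<comment> \<open>The first coordinate is the square and the second the position 1 or 2 within it;
    the inverse is 2i + s.\<close>
  define f :: "nat \<Rightarrow> nat \<times> nat" where "f x = ((x - 1) div 2, Suc ((x - 1) mod 2))" for x
  let ?D = "direct_sum {..<k} (\<lambda>_. trivial_snake)"
  have gD: "ground ?D = {..<k} \<times> {1..2}"
    by (auto simp: direct_sum_def trivial_snake_def lpm_def transversal_matroid_def)
  have g: "ground (lpm P Q) = {1..2 * k}"
    using k by (simp add: lpm_def transversal_matroid_def)
  have "f (2 * i + s) = (i, s)" if "s \<in> {1..2}" for i s
  proof -
    from that consider "s = 1" | "s = 2" by force
    then show ?thesis by cases (auto simp: f_def)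
  qed
  then have bij: "bij_betw f {1..2 * k} ({..<k} \<times> {1..2})"
    by (intro bij_betw_byWitness[of _ "\<lambda>(i, s). 2 * i + s"]) (auto simp: f_def)
  moreover have "X \<in> indep (lpm P Q) \<longleftrightarrow> f ` X \<in> indep ?D" if X: "X \<subseteq> {1..2 * k}" for X
  proof -
    have inj: "inj_on f X" using bij X by (meson bij_betw_imp_inj_on inj_on_subset)
    have fX: "f ` X \<subseteq> {..<k} \<times> {1..2}" using bij X by (auto simp: bij_betw_def)
    have "f ` X \<in> indep ?D \<longleftrightarrow>
        (\<forall>i<k. (f ` X) `` {i} \<subseteq> {1..2} \<and> (\<forall>s\<in>(f ` X) `` {i}. \<forall>t\<in>(f ` X) `` {i}. s = t))"
      using fX gD by (simp add: direct_sum_def indep_trivial_snake Ball_def)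
    also have "\<dots> \<longleftrightarrow> (\<forall>i<k. \<forall>s t. (i, s) \<in> f ` X \<longrightarrow> (i, t) \<in> f ` X \<longrightarrow> s = t)"
      using fX by blast
    also have "\<dots> \<longleftrightarrow> (\<forall>p\<in>f ` X. \<forall>q\<in>f ` X. fst p = fst q \<longrightarrow> snd p = snd q)"
      using fX unfolding Ball_def split_paired_All fst_conv snd_conv by blast
    also have "\<dots> \<longleftrightarrow> inj_on (\<lambda>x. (x - 1) div 2) X"
      using inj by (auto simp: inj_on_def f_def)
    finally show ?thesis using indep_alternating[OF assms(2)] X k by simp
  qed
  ultimately show ?thesis
    unfolding sum_of_trivial_snakes_def matroid_iso_def using g gD by metis
qed

theorem theorem1p3:
  fixes M :: "'a indep_system"
  assumes "lattice_path_matroid M"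
    and "\<not> (\<exists>e. is_loop M e)"
    and "\<not> (\<exists>e. is_coloop M e)"
    and "\<not> sum_of_trivial_snakes M"
  shows "tutte M 2 0 * tutte M 0 2 \<ge> 4 / 3 * (tutte M 1 1)\<^sup>2"
proof -
  obtain m r P Q where "matroid M" and PQ: "path_to m r P" "path_to m r Q" "never_above P Q"
    and iso: "matroid_iso M (lpm P Q)"
    using assms(1) by (auto simp: lattice_path_matroid_def)
  interpret path_pair P Q
    using PQ length_eq_count_steps[of P] length_eq_count_steps[of Q]
    by unfold_locales (auto simp: path_to_def)
  \<comment> \<open>A common step from a common point would yield a coloop of \<open>M\<close> if
    North and a loop if East.\<close>
  have "P ! i \<noteq> Q ! i" if i: "i < length P" "height P i = height Q i" for i
  proof
    assume eq: "P ! i = Q ! i"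
    show False
    proof (cases "P ! i")
      case North
      have "Suc i \<in> ground (lpm P Q)" using i by (simp add: lpm_def transversal_matroid_def)
      then show False
        using iso_coloop[OF \<open>matroid M\<close> iso] common_North_extends[OF i] North eq assms(3) by metis
    next
      case East
      then show False using iso_loop[OF iso common_East_loop[OF i]] eq assms(2) by simp
    qed
  qed
  moreover have "\<not> (even (length P) \<and> alternating (length P))"
    using alternating_iso matroid_iso_trans[OF iso] assms(4)
    unfolding sum_of_trivial_snakes_def by blast
  ultimately show ?thesis
    using tutte_bound by (simp add: tutte_iso[OF iso])
qed

end
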